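(* Let $m\ge 2$ and $n\ge 1$ be integers and let $\mathcal{Q}=(\mathcal{A},\mathcal{B},-\mathcal{I})\in\mathcal{F}_{m,n}$, where $\mathcal{I}$ is the unit tensor. Assume that $\mathcal{A}$ and $\mathcal{B}$ are both symmetric and $\mathcal{A}$ is copositive. Let $(\bar\lambda,\bar x)$ be an $m$-degree Pareto-eigenpair of $\mathcal{Q}$. If $\bar\lambda>0$, then $(\bar u,\bar v)$ is a stationary point of the problem $$\max\ \varphi_0(u,v):=m(m-1)^{\frac1m-1}v^\top u^{[m-1]}-\mathcal{B}u^m\quad\text{s.t.}\quad \mathcal{A}u^m+v^\top v^{[m-1]}=1,\ u\ge 0,\ v\ge 0,$$ where $$(\bar u,\bar v)=\frac{1}{\left(\mathcal{A}\bar x^m+\bar y^\top\bar y^{[m-1]}\right)^{\frac1m}}(\bar x,\bar y)\quad\text{with}\quad \bar y=(m-1)^{-\frac1m}\bar\lambda^{-1}\bar x.$$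
   Context: $\mathcal{T}_{m,n}$ is the space of real $m$-th order $n$-dimensional tensors $\mathcal{A}=(a_{i_1\ldots i_m})$, and $\mathcal{F}_{m,n}=\mathcal{T}_{m,n}\times\mathcal{T}_{m,n}\times\mathcal{T}_{m,n}$. A tensor is symmetric if its entries are invariant under any permutation of the indices. The unit tensor $\mathcal{I}\in\mathcal{T}_{m,n}$ has entries $1$ when $i_1=\cdots=i_m$ and $0$ otherwise. For $x\in\mathbb{R}^n$, $\mathcal{A}x^{m-1}\in\mathbb{R}^n$ has $i$-th component $\sum_{i_2,\ldots,i_m=1}^n a_{ii_2\ldots i_m}x_{i_2}\cdots x_{i_m}$, and $\mathcal{A}x^m=\langle x,\mathcal{A}x^{m-1}\rangle$. $\mathcal{A}$ is copositive if $\mathcal{A}x^m\ge 0$ for all $x\in\mathbb{R}^n_+\setminus\{0\}$. For an integer $r\ge 0$, $x^{[r]}=(x_1^r,\ldots,x_n^r)^\top$ (so $x^{[0]}=(1,\ldots,1)^\top$); $\mathrm{diag}(x)$ is the diagonal matrix with diagonal $x$. $(\lambda,x)\in\mathbb{R}\times(\mathbb{R}^n\setminus\{0\})$ is an $m$-degree Pareto-eigenpair of $(\mathcal{A},\mathcal{B},\mathcal{C})$ if $x\ge 0$, $(\lambda^m\mathcal{A}+\lambda\mathcal{B}+\mathcal{C})x^{m-1}\ge 0$ (componentwise) and $\langle x,(\lambda^m\mathcal{A}+\lambda\mathcal{B}+\mathcal{C})x^{m-1}\rangle=0$. A stationary point of the optimization problem means a KKT point: $(\bar u,\bar v)$ such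 that there exist $\bar\alpha,\bar\beta\in\mathbb{R}^n$ and $\bar\gamma\in\mathbb{R}$ with $m\mathcal{B}\bar u^{m-1}-m(m-1)^{\frac1m}\mathrm{diag}(\bar v)\bar u^{[m-2]}=\bar\alpha+\bar\gamma m\mathcal{A}\bar u^{m-1}$; $-m(m-1)^{\frac1m-1}\bar u^{[m-1]}=\bar\beta+\bar\gamma m\bar v^{[m-1]}$; $\bar\alpha\ge0,\ \bar u\ge0,\ \bar\alpha^\top\bar u=0$; $\bar\beta\ge0,\ \bar v\ge0,\ \bar\beta^\top\bar v=0$; $\mathcal{A}\bar u^m+\bar v^\top\bar v^{[m-1]}=1$. *)

theory Defs
  imports "HOL-Analysis.Analysis" "HOL-Combinatorics.Permutations"
begin

text \<open>
  The space \<open>\<real>\<^sup>n\<close> is \<^typ>\<open>real ^ 'n\<close> with \<open>n = CARD('n)\<close>, so \<open>n \<ge> 1\<close> holds automatically;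
  the order \<open>\<le>\<close> on it is componentwise.
  A tensor of order \<open>m\<close> is a function on index lists, of which only the values at lists of
  length \<open>m\<close> are its entries; values at other lists are never consulted. Since the type does not
  record the order, \<open>m\<close> is an argument of the operations below; \<open>m - 1\<close> and \<open>m - 2\<close> are natural
  number subtractions, which are not truncated when \<open>m \<ge> 2\<close>.
\<close>

type_synonym 'n tensor = "'n list \<Rightarrow> real"

definition symmetric_tensor :: "nat \<Rightarrow> 'n tensor \<Rightarrow> bool" where
  "symmetric_tensor m A \<longleftrightarrow>
     (\<forall>\<pi> is. \<pi> permutes {..<m} \<longrightarrow> length is = m \<longrightarrow> A (permute_list \<pi> is) = A is)"

definition unit_tensor :: "'n tensor" where
  "unit_tensor is = (if \<forall>i\<in>set is. \<forall>j\<in>set is. i = j then 1 else 0)"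

text \<open>The vector \<open>A x\<^sup>m\<^sup>-\<^sup>1\<close> and the scalar \<open>A x\<^sup>m\<close>, for a tensor \<open>A\<close> of order \<open>m\<close>.\<close>

definition tensor_vec :: "nat \<Rightarrow> 'n::finite tensor \<Rightarrow> real ^ 'n \<Rightarrow> real ^ 'n" where
  "tensor_vec m A x =
     (\<chi> i. \<Sum>is | length is = m - 1. A (i # is) * (\<Prod>j\<leftarrow>is. x $ j))"

definition tensor_form :: "nat \<Rightarrow> 'n::finite tensor \<Rightarrow> real ^ 'n \<Rightarrow> real" where
  "tensor_form m A x = x \<bullet> tensor_vec m A x"

definition copositive :: "nat \<Rightarrow> 'n::finite tensor \<Rightarrow> bool" where
  "copositive m A \<longleftrightarrow> (\<forall>x. 0 \<le> x \<and> x \<noteq> 0 \<longrightarrow> 0 \<le> tensor_form m A x)"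

definition vec_pow :: "real ^ 'n::finite \<Rightarrow> nat \<Rightarrow> real ^ 'n" where
  "vec_pow x r = (\<chi> i. (x $ i) ^ r)"

definition diag :: "real ^ 'n::finite \<Rightarrow> real ^ 'n ^ 'n" where
  "diag x = (\<chi> i j. if i = j then x $ i else 0)"

definition pareto_eigenpair ::
  "nat \<Rightarrow> 'n::finite tensor \<times> 'n tensor \<times> 'n tensor \<Rightarrow> real \<times> (real ^ 'n) \<Rightarrow> bool" where
  "pareto_eigenpair m = (\<lambda>(A, B, C) (l, x).
     let w = tensor_vec m (\<lambda>is. l ^ m * A is + l * B is + C is) x
     in x \<noteq> 0 \<and> 0 \<le> x \<and> 0 \<le> w \<and> x \<bullet> w = 0)"

text \<open>
  Stationary points of the problem of maximising
  \<open>\<phi>\<^sub>0(u, v) = m (m - 1)\<^bsup>1/m - 1\<^esup> v\<^sup>T u\<^bsup>[m-1]\<^esup> - B u\<^sup>m\<close>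
  subject to \<open>A u\<^sup>m + v\<^sup>T v\<^bsup>[m-1]\<^esup> = 1\<close>, \<open>u \<ge> 0\<close>, \<open>v \<ge> 0\<close>, in the sense of KKT points.
  The two vector equations say that \<open>- \<nabla>\<phi>\<^sub>0\<close>, in its \<open>u\<close> and \<open>v\<close> parts, is \<open>(\<alpha>, \<beta>)\<close> plus \<open>\<gamma>\<close> times
  the gradient of the equality constraint (for symmetric \<open>A\<close> and \<open>B\<close>).
\<close>

definition stationary_point ::
  "nat \<Rightarrow> 'n::finite tensor \<Rightarrow> 'n tensor \<Rightarrow> (real ^ 'n) \<times> (real ^ 'n) \<Rightarrow> bool" where
  "stationary_point m A B = (\<lambda>(u, v). \<exists>(\<alpha> :: real ^ 'n) (\<beta> :: real ^ 'n) (\<gamma> :: real).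
     real m *\<^sub>R tensor_vec m B u
         - (real m * (real m - 1) powr (1 / real m)) *\<^sub>R (diag v *v vec_pow u (m - 2))
       = \<alpha> + (\<gamma> * real m) *\<^sub>R tensor_vec m A u \<and>
     - ((real m * (real m - 1) powr (1 / real m - 1)) *\<^sub>R vec_pow u (m - 1))
       = \<beta> + (\<gamma> * real m) *\<^sub>R vec_pow v (m - 1) \<and>
     0 \<le> \<alpha> \<and> 0 \<le> u \<and> \<alpha> \<bullet> u = 0 \<and>
     0 \<le> \<beta> \<and> 0 \<le> v \<and> \<beta> \<bullet> v = 0 \<and>
     tensor_form m A u + v \<bullet> vec_pow v (m - 1) = 1)"

end

theory Submission imports Defs begin

text \<open>
  The KKT system turns out to be a rescaled copy of the eigenvalue system, with explicit
  multipliers. Write \<open>w = l\<^sup>m A x\<^sup>m\<^sup>-\<^sup>1 + l B x\<^sup>m\<^sup>-\<^sup>1 - x\<^bsup>[m-1]\<^esup>\<close> for the vector of the Pareto condition,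
  and \<open>y = c x\<close> with \<open>c = (m - 1)\<^bsup>-1/m\<^esup> / l\<close>. Since \<open>(m - 1)\<^bsup>1/m\<^esup> c = 1/l\<close>, dividing \<open>w\<close> by \<open>l\<close> gives
  \<open>B x\<^sup>m\<^sup>-\<^sup>1 - (m - 1)\<^bsup>1/m\<^esup> c x\<^bsup>[m-1]\<^esup> = w / l - l\<^sup>m\<^sup>-\<^sup>1 A x\<^sup>m\<^sup>-\<^sup>1\<close>,
  which, multiplied by \<open>m\<close>, is the first KKT equation at \<open>(x, y)\<close> with \<open>\<gamma> = - l\<^sup>m\<^sup>-\<^sup>1\<close> and \<open>\<alpha> = m w / l\<close>; sign and
  complementarity of \<open>\<alpha>\<close> are those of \<open>w\<close>. The constant \<open>c\<close> is such that
  \<open>(l c)\<^sup>m\<^sup>-\<^sup>1 = (m - 1)\<^bsup>1/m - 1\<^esup>\<close>, which makes the second equation hold with the same \<open>\<gamma>\<close> and \<open>\<beta> = 0\<close>.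

  Both equations are homogeneous of degree \<open>m - 1\<close> in the point, so they survive the
  rescaling to \<open>(u, v)\<close>, with \<open>\<alpha>\<close> rescaled accordingly. The rescaling achieves the normalisation
  \<open>A u\<^sup>m + v\<^sup>T v\<^bsup>[m-1]\<^esup> = 1\<close> because this form is homogeneous of degree \<open>m\<close> and positive at \<open>(x, y)\<close>:
  the first summand is nonnegative by copositivity, the second is the sum of the \<open>m\<close>-th powers of
  the entries of a nonzero nonnegative vector.
\<close>

lemma tensor_vec_add:
  "tensor_vec m (\<lambda>is. A is + B is) x = tensor_vec m A x + tensor_vec m B x"
  by (simp add: tensor_vec_def vec_eq_iff distrib_right sum.distrib)

lemma tensor_vec_mult:
  "tensor_vec m (\<lambda>is. a * A is) x = a *\<^sub>R tensor_vec m A x"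
  by (simp add: tensor_vec_def vec_eq_iff sum_distrib_left mult.assoc)

lemma tensor_vec_uminus:
  "tensor_vec m (- A) x = - tensor_vec m A x"
  by (simp add: tensor_vec_def vec_eq_iff sum_negf)

lemma prod_list_mult_const:
  fixes s :: "'b::comm_monoid_mult"
  shows "(\<Prod>j\<leftarrow>is. s * f j) = s ^ length is * (\<Prod>j\<leftarrow>is. f j)"
  by (induction "is") (simp_all add: ac_simps)

lemma tensor_vec_scaleR:
  "tensor_vec m A (s *\<^sub>R x) = s ^ (m - 1) *\<^sub>R tensor_vec m A x"
  by (simp add: tensor_vec_def vec_eq_iff prod_list_mult_const sum_distrib_left mult.left_commute)

lemma vec_pow_scaleR: "vec_pow (s *\<^sub>R x) r = s ^ r *\<^sub>R vec_pow x r"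
  by (simp add: vec_pow_def vec_eq_iff power_mult_distrib)

text \<open>Row \<open>i\<close> of the unit tensor has a single nonzero entry, at the index list \<open>i, \<dots>, i\<close>.\<close>

lemma tensor_vec_unit_tensor: "tensor_vec m unit_tensor x = vec_pow x (m - 1)"
proof -
  have "(\<Sum>is | length is = m - 1. unit_tensor (i # is) * (\<Prod>j\<leftarrow>is. x $ j)) = (x $ i) ^ (m - 1)"
    for i
  proof -
    have fin: "finite {is :: 'a list. length is = m - 1}"
      using finite_lists_length_eq[of "UNIV :: 'a set" "m - 1"] by simp
    have "unit_tensor (i # is) = (if is = replicate (m - 1) i then 1 else 0)"
      if "length is = m - 1" for "is"
    proof -
      have "is = replicate (m - 1) i \<longleftrightarrow> (\<forall>j\<in>set is. j = i)"
        using that by (metis in_set_replicate replicate_eqI)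
      then show ?thesis
        by (auto simp: unit_tensor_def)
    qed
    then have "(\<Sum>is | length is = m - 1. unit_tensor (i # is) * (\<Prod>j\<leftarrow>is. x $ j)) =
        (\<Sum>is | length is = m - 1. if is = replicate (m - 1) i then \<Prod>j\<leftarrow>is. x $ j else 0)"
      by (intro sum.cong) auto
    also have "\<dots> = (x $ i) ^ (m - 1)"
      using fin by (simp add: sum.delta)
    finally show ?thesis .
  qed
  then show ?thesis
    by (simp add: tensor_vec_def vec_pow_def)
qed

lemma inner_vec_pow_pos:
  assumes "0 \<le> x" "x \<noteq> 0"
  shows "0 < x \<bullet> vec_pow x r"
proof -
  obtain i where "x $ i \<noteq> 0"
    using assms(2) by (auto simp: vec_eq_iff)
  moreover have nonneg: "0 \<le> x $ j" for j
    using assms(1) by (simp add: less_eq_vec_def)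
  ultimately have "0 < x $ i"
    using less_eq_real_def by metis
  then have "0 < (\<Sum>j\<in>UNIV. x $ j * (x $ j) ^ r)"
    using nonneg by (intro sum_pos2[where i = i]) auto
  then show ?thesis
    by (simp add: inner_vec_def vec_pow_def)
qed

lemma diag_mult_vec_pow: "diag v *v vec_pow v r = vec_pow v (Suc r)"
  by (simp add: diag_def vec_pow_def matrix_vector_mult_def vec_eq_iff if_distrib
      if_distribR sum.delta cong: if_cong)

lemma diag_scaleR_mult_vec: "diag (c *\<^sub>R v) *v z = c *\<^sub>R (diag v *v z)"
  by (simp add: diag_def matrix_vector_mult_def vec_eq_iff if_distrib
      if_distribR sum.delta mult.assoc cong: if_cong)

theorem theorem3p2:
  fixes m :: nat and A B :: "'n::finite tensor" and l :: real and x y u v :: "real ^ 'n"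
  assumes "m \<ge> 2"
    and "symmetric_tensor m A" and "symmetric_tensor m B" and "copositive m A"
    and "pareto_eigenpair m (A, B, - unit_tensor) (l, x)"
    and "l > 0"
    and "y = ((real m - 1) powr (- 1 / real m) * inverse l) *\<^sub>R x"
    and "(u, v) =
      (1 / (tensor_form m A x + y \<bullet> vec_pow y (m - 1)) powr (1 / real m)) *\<^sub>R (x, y)"
  shows "stationary_point m A B (u, v)"
proof -
  define q where "q = (real m - 1) powr (1 / real m)"
  define c where "c = (real m - 1) powr (- 1 / real m) * inverse l"
  define D where "D = tensor_form m A x + y \<bullet> vec_pow y (m - 1)"
  define s where "s = 1 / D powr (1 / real m)"
  define w where "w = l ^ m *\<^sub>R tensor_vec m A x + l *\<^sub>R tensor_vec m B x - vec_pow x (m - 1)"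
  have m: "real m - 1 > 0" "m = Suc (m - 1)" "m - 1 = Suc (m - 2)"
    using \<open>m \<ge> 2\<close> by auto
  have "tensor_vec m (\<lambda>is. l ^ m * A is + l * B is + (- unit_tensor) is) x = w"
    by (simp only: tensor_vec_add tensor_vec_mult tensor_vec_uminus tensor_vec_unit_tensor
        w_def diff_conv_add_uminus)
  then have x: "x \<noteq> 0" "0 \<le> x" and w: "0 \<le> w" "x \<bullet> w = 0"
    using assms(5) by (auto simp: pareto_eigenpair_def Let_def)

  have q: "q > 0"
    using m by (simp add: q_def)
  have c: "c = inverse (q * l)"
    by (simp add: c_def q_def powr_minus)
  have c_pos: "c > 0"
    using q \<open>l > 0\<close> by (simp add: c)
  have y: "y = c *\<^sub>R x"
    using assms(7) by (simp add: c_def)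
  have y_nonneg: "0 \<le> y" "y \<noteq> 0"
    using x c_pos by (auto simp: y less_eq_vec_def)
  have "D > 0"
    using x assms(4) inner_vec_pow_pos[OF y_nonneg, of "m - 1"]
    by (simp add: D_def copositive_def add_nonneg_pos)
  then have s_pos: "s > 0"
    by (simp add: s_def)
  have "s ^ m = 1 / (D powr (1 / real m)) ^ m"
    by (simp add: s_def power_one_over)
  also have "(D powr (1 / real m)) ^ m = D"
    using \<open>D > 0\<close> \<open>m \<ge> 2\<close> by (simp add: powr_power)
  finally have sD: "s ^ m * D = 1"
    using \<open>D > 0\<close> by simp
  have u: "u = s *\<^sub>R x" and v: "v = s *\<^sub>R y"
    using assms(8) by (simp_all add: s_def D_def)

  have lc: "(l * c) ^ (m - 1) = (real m - 1) powr (1 / real m - 1)"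
  proof -
    have "l * c = (real m - 1) powr (- 1 / real m)"
      using \<open>l > 0\<close> by (simp add: c_def field_simps)
    then have "(l * c) ^ (m - 1) = ((real m - 1) powr (- 1 / real m)) ^ (m - 1)"
      by (rule arg_cong)
    also have "\<dots> = (real m - 1) powr ((- 1 / real m) * real (m - 1))"
      using m(1) by (simp only: powr_power) simp
    also have "(- 1 / real m) * real (m - 1) = 1 / real m - 1"
      using \<open>m \<ge> 2\<close> by (simp add: of_nat_diff field_simps)
    finally show ?thesis .
  qed

  define \<alpha> where "\<alpha> = (s ^ (m - 1) * real m / l) *\<^sub>R w"
  define \<gamma> where "\<gamma> = - (l ^ (m - 1))"

  have diag: "diag v *v vec_pow u (m - 2) = (s ^ (m - 1) * c) *\<^sub>R vec_pow x (m - 1)"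
  proof -
    have "diag v *v vec_pow u (m - 2) = c *\<^sub>R (diag u *v vec_pow u (m - 2))"
      by (simp add: u v y diag_scaleR_mult_vec)
    also have "diag u *v vec_pow u (m - 2) = s ^ (m - 1) *\<^sub>R vec_pow x (m - 1)"
      unfolding diag_mult_vec_pow m(3)[symmetric] by (simp only: u vec_pow_scaleR)
    finally show ?thesis by simp
  qed
  have lm: "l ^ m = l * l ^ (m - 1)"
    by (subst m(2)) (rule power_Suc)
  have eq1: "real m *\<^sub>R tensor_vec m B u - (real m * q) *\<^sub>R (diag v *v vec_pow u (m - 2))
      = \<alpha> + (\<gamma> * real m) *\<^sub>R tensor_vec m A u"
    unfolding diag using q \<open>l > 0\<close>
    by (simp add: u tensor_vec_scaleR \<alpha>_def \<gamma>_def w_def c lm vec_eq_iff field_simps)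
  have eq2: "- ((real m * (real m - 1) powr (1 / real m - 1)) *\<^sub>R vec_pow u (m - 1))
      = 0 + (\<gamma> * real m) *\<^sub>R vec_pow v (m - 1)"
    unfolding lc[symmetric]
    by (simp add: u v y vec_pow_scaleR \<gamma>_def power_mult_distrib mult_ac)
  have sm: "s ^ m = s * s ^ (m - 1)"
    by (subst m(2)) (rule power_Suc)
  have norm: "tensor_form m A u + v \<bullet> vec_pow v (m - 1) = 1"
  proof -
    have "tensor_form m A u + v \<bullet> vec_pow v (m - 1) = s ^ m * D"
      by (simp add: tensor_form_def u v tensor_vec_scaleR vec_pow_scaleR D_def sm algebra_simps)
    then show ?thesis using sD by simp
  qed
  have "0 \<le> \<alpha>" "0 \<le> u" "0 \<le> v"
    using w x y_nonneg s_pos \<open>l > 0\<close> by (auto simp: \<alpha>_def u v less_eq_vec_def)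
  moreover have "\<alpha> \<bullet> u = 0"
    using w by (simp add: \<alpha>_def u inner_commute)
  ultimately show ?thesis
    unfolding stationary_point_def prod.case
    using eq1[unfolded q_def] eq2 norm
    by (intro exI[of _ \<alpha>] exI[of _ 0] exI[of _ \<gamma>]) simp
qed

end
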